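(* Let $1 \leq q \leq p \leq \infty$ and let $r \in [1,\infty]$ be defined by $1/r = 1/q - 1/p$. Let $A : \ell_p \to \ell_q$ be a bounded linear operator whose matrix $(a_{j,k})$ satisfies $a_{j,k} \geq 0$ for all $j,k$. Then (regardless of whether $r \geq 2$ or $r \leq 2$) \[ \left( \sum_{j,k} a_{j,k}^r \right)^{1/r} \leq \|A\|_{p,q}, \] where for $r=\infty$ the left-hand side is read as $\sup_{j,k} a_{j,k}$.
   Context: For $1 \leq p < \infty$, $\ell_p$ is the complex Banach space of complex sequences $x=(x_k)$ with $\|x\|_p = \left(\sum_k |x_k|^p\right)^{1/p} < \infty$. For the index $\infty$, $\ell_\infty$ as a domain or codomain of operators stands for $c_0$, the space of complex null sequences with the norm $\|x\|_\infty = \sup_k |x_k|$. For a bounded linear operator $A : \ell_p \to \ell_q$, $\|A\|_{p,q} = \sup\{\|Ax\|_q : x \in \ell_p, \|x\|_p \leq 1\}$ is the operator norm. The matrix $(a_{j,k})$ of $A$ with respect to the usual bases $(e_k)$ is given by: $a_{j,k}$ is the $j$-th coordinate of $A e_k$. The convention $1/\infty = 0$ is used. *)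

theory Defs
  imports "HOL-Analysis.Analysis"
begin

text \<open>
  The exponent ranges over \<open>[1,\<infinity>]\<close>, represented in \<^typ>\<open>ereal\<close>, where \<open>1 / \<infinity> = 0\<close>.
  The norm is extended-valued: it is \<open>\<infinity>\<close> for families that are not \<open>p\<close>-summable
  (resp. unbounded, if \<open>p = \<infinity>\<close>). The index type is left general so that the same definition
  covers sequences and double sequences.
\<close>

definition lp_norm :: "ereal \<Rightarrow> ('i \<Rightarrow> complex) \<Rightarrow> ereal" where
  "lp_norm p x =
    (if p = \<infinity> then (SUP i. ereal (cmod (x i)))
     else if (\<lambda>i. cmod (x i) powr real_of_ereal p) summable_on UNIV
     then ereal ((\<Sum>\<^sub>\<infinity>i. cmod (x i) powr real_of_ereal p) powr (1 / real_of_ereal p))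
     else \<infinity>)"

text \<open>For the index \<open>\<infinity>\<close> the space is \<open>c\<^sub>0\<close>, not the space of all bounded sequences.\<close>

definition lp_space :: "ereal \<Rightarrow> (nat \<Rightarrow> complex) set" where
  "lp_space p = (if p = \<infinity> then {x. x \<longlonglongrightarrow> 0} else {x. lp_norm p x < \<infinity>})"

text \<open>Operators are total functions whose values outside \<^term>\<open>lp_space p\<close> are irrelevant.\<close>

definition lp_bounded_linear ::
    "ereal \<Rightarrow> ereal \<Rightarrow> ((nat \<Rightarrow> complex) \<Rightarrow> (nat \<Rightarrow> complex)) \<Rightarrow> bool" where
  "lp_bounded_linear p q A \<longleftrightarrow>
    (\<forall>x\<in>lp_space p. A x \<in> lp_space q) \<and>
    (\<forall>x\<in>lp_space p. \<forall>y\<in>lp_space p. A (\<lambda>k. x k + y k) = (\<lambda>j. A x j + A y j)) \<and>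
    (\<forall>c. \<forall>x\<in>lp_space p. A (\<lambda>k. c * x k) = (\<lambda>j. c * A x j)) \<and>
    (\<exists>C::real. \<forall>x\<in>lp_space p. lp_norm q (A x) \<le> ereal C * lp_norm p x)"

definition lp_opnorm ::
    "ereal \<Rightarrow> ereal \<Rightarrow> ((nat \<Rightarrow> complex) \<Rightarrow> (nat \<Rightarrow> complex)) \<Rightarrow> ereal" where
  "lp_opnorm p q A = (SUP x \<in> {x \<in> lp_space p. lp_norm p x \<le> 1}. lp_norm q (A x))"

definition unit_seq :: "nat \<Rightarrow> nat \<Rightarrow> complex" where
  "unit_seq k = (\<lambda>i. if i = k then 1 else 0)"

definition matrix_entry ::
    "((nat \<Rightarrow> complex) \<Rightarrow> (nat \<Rightarrow> complex)) \<Rightarrow> nat \<Rightarrow> nat \<Rightarrow> complex" where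
  "matrix_entry A j k = A (unit_seq k) j"

end

theory Submission
  imports Defs
begin

text \<open>
  If \<open>r = \<infinity>\<close>, the bound holds because every entry is a coordinate of the image of a unit vector.
  Otherwise \<open>q\<close> is finite, and the only difficulty is to choose a good test vector. It suffices to
  bound \<open>S = (\<Sum>j\<in>J. \<Sum>k\<in>K. a\<^sub>j\<^sub>k\<^sup>r)\<close> for finite \<open>J\<close> and \<open>K\<close>. For \<open>x \<ge> 0\<close>
  supported in \<open>K\<close>, two uses of the superadditivity of powers with exponent at least \<open>1\<close> (here the
  nonnegativity of the matrix enters, since it excludes cancellation) give
  \<open>\<Sum>j. (\<Sum>k. a\<^sub>j\<^sub>k x\<^sub>k)\<^sup>q \<ge> \<Sum>k. x\<^sub>k\<^sup>q (\<Sum>j. a\<^sub>j\<^sub>k\<^sup>q) \<ge> \<Sum>k. x\<^sub>k\<^sup>q c\<^sub>k powr (q/r)\<close>,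
  where \<open>c\<^sub>k = (\<Sum>j. a\<^sub>j\<^sub>k\<^sup>r)\<close>. The exponents \<open>p/q\<close> and \<open>r/q\<close> are
  conjugate, so the last expression is a duality pairing, whose maximum over the unit ball of
  \<open>\<ell>\<^sub>p\<close> is \<open>S powr (q/r)\<close>, attained where equality holds in Hoelder's inequality, at
  \<open>x\<^sub>k = (c\<^sub>k / S) powr (1/p)\<close>. Only the value at this vector is used, so Hoelder's
  inequality itself does not occur; the case \<open>p = \<infinity>\<close> is covered by \<open>1/p = 0\<close>, where the
  test vector is the indicator of \<open>{k \<in> K. c\<^sub>k \<noteq> 0}\<close>, and is a null sequence because \<open>K\<close> is finite.
  The finite inequality is \<open>powr_sum_test_vector\<close>; its interpretation as a lower bound for the
  operator norm is \<open>finite_powr_sum_le_opnorm\<close>.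
\<close>

section \<open>Finite inequalities for powers\<close>

text \<open>
  Each term satisfies \<open>u\<^sup>s = u u\<^sup>s\<^sup>-\<^sup>1 \<le> u T\<^sup>s\<^sup>-\<^sup>1\<close>, where \<open>T\<close> is the whole sum.
\<close>

lemma sum_powr_le_powr_sum:
  fixes u :: "'a \<Rightarrow> real"
  assumes "finite I" and u: "\<And>i. i \<in> I \<Longrightarrow> 0 \<le> u i" and s: "1 \<le> s"
  shows "(\<Sum>i\<in>I. u i powr s) \<le> (\<Sum>i\<in>I. u i) powr s"
proof -
  let ?T = "\<Sum>i\<in>I. u i"
  have T: "0 \<le> ?T"
    by (intro sum_nonneg u)
  have split: "v powr s = v * v powr (s - 1)" if "0 \<le> v" for v :: real
    using powr_mult_base[OF that, of "s - 1"] by simp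
  have "u i powr s \<le> u i * ?T powr (s - 1)" if i: "i \<in> I" for i
  proof -
    have "u i \<le> ?T"
      using assms(1) i u by (intro member_le_sum) auto
    then have "u i powr (s - 1) \<le> ?T powr (s - 1)"
      using u[OF i] s by (intro powr_mono2) auto
    then show ?thesis
      using u[OF i] by (simp add: split mult_left_mono)
  qed
  then have "(\<Sum>i\<in>I. u i powr s) \<le> (\<Sum>i\<in>I. u i * ?T powr (s - 1))"
    by (rule sum_mono)
  also have "\<dots> = ?T powr s"
    using split[OF T] by (simp add: sum_distrib_right)
  finally show ?thesis .
qed

text \<open>
  The parameter \<open>t\<close> stands for \<open>1/p\<close>. The test vector gives \<open>\<Sum>k. x\<^sub>k\<^sup>q c\<^sub>k powr (q/r) = S powr (- q t) \<Sum>k. c\<^sub>k\<close>,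
  because the exponents of \<open>c\<^sub>k\<close> add up to \<open>q t + q / r = 1\<close>.
\<close>

lemma powr_sum_test_vector:
  fixes a :: "'j \<Rightarrow> 'k \<Rightarrow> real"
  assumes fin: "finite J" "finite K" and a: "\<And>j k. 0 \<le> a j k"
    and q: "1 \<le> q" and t: "0 \<le> t" and r: "0 < r" "1 / r = 1 / q - t"
    and c: "\<And>k. c k = (\<Sum>j\<in>J. a j k powr r)" and S: "S = (\<Sum>k\<in>K. c k)" "0 < S"
  shows "S powr (q / r) \<le> (\<Sum>j\<in>J. (\<Sum>k\<in>K. (c k / S) powr t * a j k) powr q)"
proof -
  have exps: "q * t + q / r = 1"
  proof -
    have "q * (1 / r) = q * (1 / q - t)"
      using r(2) by simp
    then show ?thesis
      using q by (simp add: right_diff_distrib)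
  qed
  moreover have "0 \<le> q * t"
    using q t by simp
  ultimately have "q / r \<le> 1"
    by linarith
  then have qr: "q \<le> r"
    using r(1) by simp
  have c0: "0 \<le> c k" for k
    by (simp add: c sum_nonneg)
  have column: "c k powr (q / r) \<le> (\<Sum>j\<in>J. a j k powr q)" for k
  proof -
    have "c k = (\<Sum>j\<in>J. (a j k powr q) powr (r / q))"
      using q by (simp add: c powr_powr)
    also have "\<dots> \<le> (\<Sum>j\<in>J. a j k powr q) powr (r / q)"
      using fin q qr by (intro sum_powr_le_powr_sum) auto
    finally have "c k powr (q / r) \<le> ((\<Sum>j\<in>J. a j k powr q) powr (r / q)) powr (q / r)"
      using c0 q r(1) by (intro powr_mono2) auto
    then show ?thesis
      using q r(1) by (simp add: powr_powr sum_nonneg)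
  qed
  have "S powr (q / r) = S powr (- (q * t)) * S"
  proof -
    have "q / r = - (q * t) + 1"
      using exps by simp
    then show ?thesis
      using S(2) by (simp only: powr_add) simp
  qed
  also have "\<dots> = (\<Sum>k\<in>K. S powr (- (q * t)) * c k)"
    by (simp add: S(1) sum_distrib_left)
  also have "\<dots> = (\<Sum>k\<in>K. ((c k / S) powr t) powr q * c k powr (q / r))"
  proof (rule sum.cong)
    fix k
    have "c k = c k powr (q * t + q / r)"
      using c0 by (simp add: exps)
    also have "\<dots> = c k powr (q * t) * c k powr (q / r)"
      by (rule powr_add)
    finally show "S powr (- (q * t)) * c k = ((c k / S) powr t) powr q * c k powr (q / r)"
      using c0 S(2) by (simp add: powr_powr powr_divide powr_minus_divide mult.commute)
  qed simp
  also have "\<dots> \<le> (\<Sum>k\<in>K. ((c k / S) powr t) powr q * (\<Sum>j\<in>J. a j k powr q))"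
    by (intro sum_mono mult_left_mono column) simp
  also have "\<dots> = (\<Sum>j\<in>J. \<Sum>k\<in>K. ((c k / S) powr t * a j k) powr q)"
    using a by (subst sum.swap) (simp add: sum_distrib_left powr_mult)
  also have "\<dots> \<le> (\<Sum>j\<in>J. (\<Sum>k\<in>K. (c k / S) powr t * a j k) powr q)"
    using fin a q by (intro sum_mono sum_powr_le_powr_sum) auto
  finally show ?thesis .
qed

section \<open>Finitely supported sequences\<close>

lemma lp_norm_finite_support:
  assumes "p \<noteq> \<infinity>" and "finite K" and "\<And>i. i \<notin> K \<Longrightarrow> x i = 0"
  shows "lp_norm p x
    = ereal ((\<Sum>i\<in>K. cmod (x i) powr real_of_ereal p) powr (1 / real_of_ereal p))"
proof -
  have "((\<lambda>i. cmod (x i) powr real_of_ereal p) has_sum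
      (\<Sum>i\<in>K. cmod (x i) powr real_of_ereal p)) UNIV"
    using assms(2,3) by (intro has_sum_finite_neutralI) auto
  then show ?thesis
    using assms(1) by (auto simp: lp_norm_def infsumI summable_on_def)
qed

lemma lp_space_finite_support:
  assumes "finite K" and "\<And>i. i \<notin> K \<Longrightarrow> x i = 0"
  shows "x \<in> lp_space p"
proof (cases "p = \<infinity>")
  case True
  obtain n where n: "\<And>i. i \<in> K \<Longrightarrow> i < n"
    using assms(1) by (metis finite_nat_iff_bounded lessThan_iff subsetD)
  have "eventually (\<lambda>i. x i = 0) sequentially"
    unfolding eventually_sequentially using assms(2) n by (metis leD)
  then have "x \<longlonglongrightarrow> 0"
    by (rule tendsto_eventually)
  then show ?thesis
    using True by (simp add: lp_space_def)
next
  case False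
  then show ?thesis
    using lp_norm_finite_support[OF False assms] by (simp add: lp_space_def)
qed

lemma lp_bounded_linear_finite_sum:
  assumes A: "lp_bounded_linear p q A" and "finite K"
  shows "A (\<lambda>i. \<Sum>k\<in>K. x k * unit_seq k i) = (\<lambda>j. \<Sum>k\<in>K. x k * matrix_entry A j k)"
proof -
  have scale: "A (\<lambda>k. c * x k) = (\<lambda>j. c * A x j)" if "x \<in> lp_space p" for c x
    using A that by (simp add: lp_bounded_linear_def)
  have add: "A (\<lambda>k. x k + y k) = (\<lambda>j. A x j + A y j)"
    if "x \<in> lp_space p" "y \<in> lp_space p" for x y
    using A that by (simp add: lp_bounded_linear_def)
  show ?thesis
    using assms(2)
  proof (induction K rule: finite_induct)
    case empty
    have "(\<lambda>i. 0) \<in> lp_space p"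
      by (rule lp_space_finite_support[of "{}"]) auto
    then show ?case
      using scale[of "\<lambda>i. 0" 0] by simp
  next
    case (insert k K)
    have unit: "unit_seq k \<in> lp_space p"
      by (rule lp_space_finite_support[of "{k}"]) (auto simp: unit_seq_def)
    have scaled: "(\<lambda>i. x k * unit_seq k i) \<in> lp_space p"
      by (rule lp_space_finite_support[of "{k}"]) (auto simp: unit_seq_def)
    have rest: "(\<lambda>i. \<Sum>k\<in>K. x k * unit_seq k i) \<in> lp_space p"
      using insert.hyps(1)
      by (intro lp_space_finite_support[of K]) (auto simp: unit_seq_def intro!: sum.neutral)
    have "A (\<lambda>i. x k * unit_seq k i + (\<Sum>k\<in>K. x k * unit_seq k i))
        = (\<lambda>j. A (\<lambda>i. x k * unit_seq k i) j + A (\<lambda>i. \<Sum>k\<in>K. x k * unit_seq k i) j)"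
      using scaled rest by (rule add)
    moreover have "A (\<lambda>i. x k * unit_seq k i) = (\<lambda>j. x k * A (unit_seq k) j)"
      using unit by (rule scale)
    ultimately show ?case
      using insert.IH insert.hyps by (simp add: matrix_entry_def)
  qed
qed

section \<open>Lower bounds for the operator norm\<close>

lemma finite_sum_le_lp_norm:
  assumes "y \<in> lp_space q" and "1 \<le> q" and "q \<noteq> \<infinity>" and "finite J"
  shows "ereal ((\<Sum>j\<in>J. cmod (y j) powr real_of_ereal q) powr (1 / real_of_ereal q))
    \<le> lp_norm q y"
proof -
  have summ: "(\<lambda>j. cmod (y j) powr real_of_ereal q) summable_on UNIV"
    using assms(1,3) by (auto simp: lp_space_def lp_norm_def split: if_splits)
  then have "(\<Sum>j\<in>J. cmod (y j) powr real_of_ereal q)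
      \<le> (\<Sum>\<^sub>\<infinity>j. cmod (y j) powr real_of_ereal q)"
    using assms(4) by (intro finite_sum_le_infsum) auto
  moreover have "0 \<le> real_of_ereal q"
    using assms(2,3) by (cases q) auto
  ultimately show ?thesis
    using summ assms(3) by (auto simp: lp_norm_def intro!: powr_mono2 sum_nonneg)
qed

lemma lp_norm_le_opnorm:
  assumes "x \<in> lp_space p" and "lp_norm p x \<le> 1"
  shows "lp_norm q (A x) \<le> lp_opnorm p q A"
  unfolding lp_opnorm_def using assms by (intro SUP_upper) auto

lemma cmod_le_lp_norm:
  assumes "y \<in> lp_space q" and "1 \<le> q"
  shows "ereal (cmod (y j)) \<le> lp_norm q y"
proof (cases "q = \<infinity>")
  case True
  then show ?thesis
    by (auto simp: lp_norm_def intro!: SUP_upper)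
next
  case False
  then obtain q' where q': "q = ereal q'" "1 \<le> q'"
    using assms(2) by (cases q) auto
  then show ?thesis
    using finite_sum_le_lp_norm[OF assms False, of "{j}"] by (simp add: powr_powr)
qed

lemma lp_norm_unit_seq:
  assumes "1 \<le> p"
  shows "lp_norm p (unit_seq k) \<le> 1"
proof (cases "p = \<infinity>")
  case True
  then show ?thesis
    by (auto simp: lp_norm_def unit_seq_def intro!: SUP_least)
next
  case False
  then show ?thesis
    by (subst lp_norm_finite_support[of _ "{k}"]) (auto simp: unit_seq_def)
qed

lemma matrix_entry_le_opnorm:
  assumes A: "lp_bounded_linear p q A" and "1 \<le> p" "1 \<le> q"
  shows "ereal (cmod (matrix_entry A j k)) \<le> lp_opnorm p q A"
proof -
  have unit: "unit_seq k \<in> lp_space p"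
    by (rule lp_space_finite_support[of "{k}"]) (auto simp: unit_seq_def)
  then have "A (unit_seq k) \<in> lp_space q"
    using A by (auto simp: lp_bounded_linear_def)
  then have "ereal (cmod (matrix_entry A j k)) \<le> lp_norm q (A (unit_seq k))"
    unfolding matrix_entry_def using assms(3) by (rule cmod_le_lp_norm)
  also have "\<dots> \<le> lp_opnorm p q A"
    using unit assms(2) by (intro lp_norm_le_opnorm lp_norm_unit_seq)
  finally show ?thesis .
qed

lemma finite_powr_sum_le_opnorm:
  fixes q' r' t :: real
  assumes A: "lp_bounded_linear p (ereal q') A" and p: "1 \<le> p" and q: "1 \<le> q'"
    and t: "1 / p = ereal t" and r: "0 < r'" "1 / r' = 1 / q' - t"
    and nonneg: "\<And>j k. matrix_entry A j k \<in> \<real>\<^sub>\<ge>\<^sub>0"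
    and fin: "finite J" "finite K"
  shows "ereal ((\<Sum>k\<in>K. \<Sum>j\<in>J. cmod (matrix_entry A j k) powr r') powr (1 / r'))
    \<le> lp_opnorm p (ereal q') A"
proof -
  define a where "a j k = cmod (matrix_entry A j k)" for j k
  define c where "c k = (\<Sum>j\<in>J. a j k powr r')" for k
  define S where "S = (\<Sum>k\<in>K. c k)"
  have entry: "matrix_entry A j k = complex_of_real (a j k)" for j k
    using nonneg[of j k] unfolding a_def by (auto elim!: nonneg_Reals_cases)
  have c0: "0 \<le> c k" for k
    by (simp add: c_def sum_nonneg)
  have S0: "0 \<le> S"
    by (simp add: S_def c0 sum_nonneg)
  have t0: "0 \<le> t"
    using p t by (cases p) (auto simp: one_ereal_def)
  have "ereal (S powr (1 / r')) \<le> lp_opnorm p (ereal q') A"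
  proof (cases "S = 0")
    case True
    have "0 \<le> ereal (cmod (matrix_entry A 0 0))"
      by simp
    also have "\<dots> \<le> lp_opnorm p (ereal q') A"
      using A p q by (intro matrix_entry_le_opnorm) auto
    finally show ?thesis
      using True r(1) by (simp add: zero_ereal_def)
  next
    case False
    then have S1: "0 < S"
      using S0 by simp
    define x where "x i = (\<Sum>k\<in>K. complex_of_real ((c k / S) powr t) * unit_seq k i)" for i
    have x_eq: "x i = (if i \<in> K then complex_of_real ((c i / S) powr t) else 0)" for i
      using fin(2) by (simp add: x_def unit_seq_def if_distrib sum.delta cong: if_cong)
    have x_space: "x \<in> lp_space p"
      using fin(2) by (rule lp_space_finite_support) (simp add: x_eq)
    have x_norm: "lp_norm p x \<le> 1"
    proof (cases "p = \<infinity>")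
      case True
      then have "t = 0"
        using t by (simp add: zero_ereal_def)
      then have "cmod (x i) \<le> 1" for i
        by (simp add: x_eq)
      then show ?thesis
        using True by (auto simp: lp_norm_def intro!: SUP_least)
    next
      case False
      then obtain p' where p': "p = ereal p'" "1 \<le> p'"
        using p by (cases p) auto
      then have "t = 1 / p'"
        using t by (simp add: one_ereal_def)
      then have "(\<Sum>i\<in>K. cmod (x i) powr p') = (\<Sum>i\<in>K. c i / S)"
        using p' S1 c0 by (intro sum.cong) (auto simp: x_eq powr_powr)
      also have "\<dots> = 1"
        using S1 by (simp add: S_def flip: sum_divide_distrib)
      finally show ?thesis
        using lp_norm_finite_support[OF False fin(2), of x] p' by (simp add: x_eq)
    qed
    have Ax: "cmod (A x j) = (\<Sum>k\<in>K. (c k / S) powr t * a j k)" for j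
    proof -
      have "A x j = complex_of_real (\<Sum>k\<in>K. (c k / S) powr t * a j k)"
        using lp_bounded_linear_finite_sum[OF A fin(2), of "\<lambda>k. complex_of_real ((c k / S) powr t)"]
        unfolding x_def by (simp add: entry)
      moreover have "0 \<le> (\<Sum>k\<in>K. (c k / S) powr t * a j k)"
        by (intro sum_nonneg) (simp add: a_def)
      ultimately show ?thesis
        by (simp only: norm_of_real abs_of_nonneg)
    qed
    have "S powr (q' / r') \<le> (\<Sum>j\<in>J. cmod (A x j) powr q')"
      unfolding Ax using fin q t0 r S1
      by (intro powr_sum_test_vector) (auto simp: a_def c_def S_def)
    then have "(S powr (q' / r')) powr (1 / q') \<le> (\<Sum>j\<in>J. cmod (A x j) powr q') powr (1 / q')"
      using q by (intro powr_mono2) auto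
    then have "ereal (S powr (1 / r')) \<le> ereal ((\<Sum>j\<in>J. cmod (A x j) powr q') powr (1 / q'))"
      using q by (simp add: powr_powr)
    also have "\<dots> \<le> lp_norm (ereal q') (A x)"
      using finite_sum_le_lp_norm[of "A x" "ereal q'" J] A x_space q fin(1)
      by (auto simp: lp_bounded_linear_def)
    also have "\<dots> \<le> lp_opnorm p (ereal q') A"
      using x_space x_norm by (rule lp_norm_le_opnorm)
    finally show ?thesis .
  qed
  then show ?thesis
    by (simp add: S_def c_def a_def)
qed

lemma lp_norm_le_of_finite_sums:
  fixes r' m :: real
  assumes r: "0 < r'"
    and bound: "\<And>F. finite F \<Longrightarrow> (\<Sum>i\<in>F. cmod (x i) powr r') powr (1 / r') \<le> m"
  shows "lp_norm (ereal r') x \<le> ereal m"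
proof -
  have m: "0 \<le> m"
    using bound[of "{}"] by simp
  have sums: "(\<Sum>i\<in>F. cmod (x i) powr r') \<le> m powr r'" if "finite F" for F
  proof -
    have "((\<Sum>i\<in>F. cmod (x i) powr r') powr (1 / r')) powr r' \<le> m powr r'"
      using bound[OF that] r by (intro powr_mono2) auto
    then show ?thesis
      using r by (simp add: powr_powr sum_nonneg)
  qed
  then have summ: "(\<lambda>i. cmod (x i) powr r') summable_on UNIV"
    by (intro nonneg_bdd_above_summable_on) (auto intro!: bdd_aboveI)
  then have "(\<Sum>\<^sub>\<infinity>i. cmod (x i) powr r') \<le> m powr r'"
    using sums by (intro infsum_le_finite_sums) auto
  then have "(\<Sum>\<^sub>\<infinity>i. cmod (x i) powr r') powr (1 / r') \<le> (m powr r') powr (1 / r')"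
    using r by (intro powr_mono2 infsum_nonneg) auto
  then show ?thesis
    using summ r m by (simp add: lp_norm_def powr_powr)
qed

theorem mainTheorem2:
  fixes p q r :: ereal and A :: "(nat \<Rightarrow> complex) \<Rightarrow> (nat \<Rightarrow> complex)"
  assumes "1 \<le> q" and "q \<le> p"
    and "1 \<le> r" and "1 / r = 1 / q - 1 / p"
    and "lp_bounded_linear p q A"
    and "\<And>j k. matrix_entry A j k \<in> \<real>\<^sub>\<ge>\<^sub>0"
  shows "lp_norm r (\<lambda>(j, k). matrix_entry A j k) \<le> lp_opnorm p q A"
proof (cases "r = \<infinity>")
  case True
  have "1 \<le> p"
    using assms(1,2) by (rule order_trans)
  then show ?thesis
    using True matrix_entry_le_opnorm[OF assms(5) _ assms(1)]
    by (auto simp: lp_norm_def intro!: SUP_least)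
next
  case False
  then obtain r' where r': "r = ereal r'" "1 \<le> r'"
    using assms(3) by (cases r) auto
  have p1: "1 \<le> p"
    using assms(1,2) by (rule order_trans)
  \<comment> \<open>An infinite \<open>q\<close> would force \<open>p = \<infinity>\<close> and hence \<open>1/r = 0\<close>.\<close>
  have "q \<noteq> \<infinity>"
    using assms(2,4) r' by (auto simp: one_ereal_def zero_ereal_def)
  then obtain q' where q': "q = ereal q'" "1 \<le> q'"
    using assms(1) by (cases q) auto
  obtain t where t: "1 / p = ereal t"
    using p1 by (cases p) (auto simp: one_ereal_def zero_ereal_def)
  have rt: "1 / r' = 1 / q' - t"
    using assms(4) r' q' t by (simp add: one_ereal_def)
  show ?thesis
  proof (cases "lp_opnorm p q A")
    case (real m)
    have "(\<Sum>i\<in>F. cmod (case i of (j, k) \<Rightarrow> matrix_entry A j k) powr r') powr (1 / r') \<le> m"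
      if F: "finite F" for F
    proof -
      let ?f = "\<lambda>i. cmod (case i of (j, k) \<Rightarrow> matrix_entry A j k) powr r'"
      have "(\<Sum>i\<in>F. ?f i) \<le> (\<Sum>i\<in>fst ` F \<times> snd ` F. ?f i)"
        using F by (intro sum_mono2) (auto simp: rev_image_eqI)
      also have "\<dots> = (\<Sum>j\<in>fst ` F. \<Sum>k\<in>snd ` F. cmod (matrix_entry A j k) powr r')"
        by (simp add: sum.cartesian_product case_prod_unfold)
      also have "\<dots> = (\<Sum>k\<in>snd ` F. \<Sum>j\<in>fst ` F. cmod (matrix_entry A j k) powr r')"
        by (rule sum.swap)
      finally have "(\<Sum>i\<in>F. ?f i) powr (1 / r')
          \<le> (\<Sum>k\<in>snd ` F. \<Sum>j\<in>fst ` F. cmod (matrix_entry A j k) powr r') powr (1 / r')"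
        using r' by (intro powr_mono2 sum_nonneg) auto
      also have "\<dots> \<le> m"
        using finite_powr_sum_le_opnorm[OF assms(5)[unfolded q'(1)] p1 q'(2) t _ rt assms(6),
            of "fst ` F" "snd ` F"] F r' real q'(1)
        by simp
      finally show ?thesis .
    qed
    then show ?thesis
      using r' real by (simp add: lp_norm_le_of_finite_sums)
  next
    case MInf
    then show ?thesis
      using matrix_entry_le_opnorm[OF assms(5) p1 assms(1), of 0 0] by simp
  qed simp
qed

end
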